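(* Let $(X,\mathscr A,\mu)$ be a $\sigma$-finite measure space, let $\phi$ be a nonsingular transformation of $X$, and let $\mathsf N_\phi=\{x\in X\colon\mathsf h_\phi(x)=0\}$. Consider the following four conditions: (i) $\mathcal N(C_\phi)=\{0\}$; (ii) $\mu(\mathsf N_\phi)=0$; (iii) $\chi_{\mathsf N_\phi}\circ\phi=\chi_{\mathsf N_\phi}$ a.e. $[\mu]$; (iv) $\mathcal N(C_\phi)\subseteq\mathcal N(C_\phi^* )$. Then the conditions (i), (ii) and (iii) are equivalent. Moreover, if $C_\phi$ is densely defined, then the conditions (i) to (iv) are equivalent.
   Context: $L^2(\mu)$ is the complex Hilbert space of square integrable complex functions on $X$; $\chi_\Delta$ is the characteristic function of $\Delta$. A transformation $\phi\colon X\to X$ is nonsingular if $\phi^{-1}(\Delta)\in\mathscr A$ for all $\Delta\in\mathscr A$ and the measure $\mu\circ\phi^{-1}$, $\Delta\mapsto\mu(\phi^{-1}(\Delta))$, is absolutely continuous with respect to $\mu$. The composition operator $C_\phi$ in $L^2(\mu)$ is given by $\mathcal D(C_\phi)=\{f\in L^2(\mu)\colon f\circ\phi\in L^2(\mu)\}$, $C_\phi f=f\circ\phi$ (possibly unbounded, not assumed densely defined unless stated). $\mathsf h_\phi\colon X\to[0,\infty]$ is the ($\mu$-a.e. unique) $\mathscr A$-measurable function with $\mu(\phi^{-1}(\Delta))=\int_\Delta\mathsf h_\phi\,d\mu$ for all $\Delta\in\mathscr A$. $\mathcal N(A)$ denotes the kernel of an operator $A$. The adjoint $C_\phi^*$ in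 (iv) is considered only when $C_\phi$ is densely defined. *)

theory Defs
  imports "HOL-Analysis.Analysis"
begin

text \<open>
  The complex Hilbert space $L^2(\mu)$. Its elements are classes, modulo equality almost everywhere,
  of square integrable functions; values outside \<open>space M\<close> are irrelevant to the classes.
\<close>

definition sq_integrable :: "'a measure \<Rightarrow> ('a \<Rightarrow> complex) set" where
  "sq_integrable M = {f \<in> borel_measurable M. integrable M (\<lambda>x. (cmod (f x))\<^sup>2)}"

definition ae_rel :: "'a measure \<Rightarrow> (('a \<Rightarrow> complex) \<times> ('a \<Rightarrow> complex)) set" where
  "ae_rel M = {(f, g). f \<in> sq_integrable M \<and> g \<in> sq_integrable M \<and> (AE x in M. f x = g x)}"

definition L2 :: "'a measure \<Rightarrow> ('a \<Rightarrow> complex) set set" where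
  "L2 M = sq_integrable M // ae_rel M"

definition L2_class :: "'a measure \<Rightarrow> ('a \<Rightarrow> complex) \<Rightarrow> ('a \<Rightarrow> complex) set" where
  "L2_class M f = ae_rel M `` {f}"

definition L2_rep :: "('a \<Rightarrow> complex) set \<Rightarrow> 'a \<Rightarrow> complex" where
  "L2_rep F = (SOME f. f \<in> F)"

definition L2_zero :: "'a measure \<Rightarrow> ('a \<Rightarrow> complex) set" where
  "L2_zero M = L2_class M (\<lambda>x. 0)"

definition L2_diff :: "'a measure \<Rightarrow> ('a \<Rightarrow> complex) set \<Rightarrow> ('a \<Rightarrow> complex) set \<Rightarrow> ('a \<Rightarrow> complex) set" where
  "L2_diff M F G = L2_class M (\<lambda>x. L2_rep F x - L2_rep G x)"

definition L2_inner :: "'a measure \<Rightarrow> ('a \<Rightarrow> complex) set \<Rightarrow> ('a \<Rightarrow> complex) set \<Rightarrow> complex" where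
  "L2_inner M F G = (LINT x|M. L2_rep F x * cnj (L2_rep G x))"

definition L2_norm :: "'a measure \<Rightarrow> ('a \<Rightarrow> complex) set \<Rightarrow> real" where
  "L2_norm M F = sqrt (LINT x|M. (cmod (L2_rep F x))\<^sup>2)"

text \<open>
  A possibly unbounded operator in $L^2(\mu)$ is represented by its graph; its domain is the
  \<open>Domain\<close> of the graph.
\<close>

type_synonym 'a L2_op = "(('a \<Rightarrow> complex) set \<times> ('a \<Rightarrow> complex) set) set"

definition L2_kernel :: "'a measure \<Rightarrow> 'a L2_op \<Rightarrow> ('a \<Rightarrow> complex) set set" where
  "L2_kernel M A = {F. (F, L2_zero M) \<in> A}"

definition L2_densely_defined :: "'a measure \<Rightarrow> 'a L2_op \<Rightarrow> bool" where
  "L2_densely_defined M A \<longleftrightarrow>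
     (\<forall>F\<in>L2 M. \<forall>\<epsilon>>0. \<exists>G\<in>Domain A. L2_norm M (L2_diff M F G) < \<epsilon>)"

text \<open>
  The graph of the adjoint. It is the graph of a function, hence meaningful as an operator,
  only when \<open>A\<close> is densely defined.
\<close>

definition L2_adjoint :: "'a measure \<Rightarrow> 'a L2_op \<Rightarrow> 'a L2_op" where
  "L2_adjoint M A =
     {(G, H). G \<in> L2 M \<and> H \<in> L2 M \<and> (\<forall>(F, F') \<in> A. L2_inner M F' G = L2_inner M F H)}"

text \<open>
  Membership in \<open>M \<rightarrow>\<^sub>M M\<close> says that \<open>\<phi>\<close> maps \<open>space M\<close> into itself and that preimages
  (taken in \<open>space M\<close>) of measurable sets are measurable.
\<close>

definition nonsingular :: "'a measure \<Rightarrow> ('a \<Rightarrow> 'a) \<Rightarrow> bool" where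
  "nonsingular M \<phi> \<longleftrightarrow> \<phi> \<in> M \<rightarrow>\<^sub>M M \<and> absolutely_continuous M (distr M M \<phi>)"

text \<open>
  For nonsingular \<open>\<phi>\<close>, the class of \<open>f \<circ> \<phi>\<close> depends only on the class of \<open>f\<close>, so this relation
  is the graph of a function.
\<close>

definition composition_op :: "'a measure \<Rightarrow> ('a \<Rightarrow> 'a) \<Rightarrow> 'a L2_op" where
  "composition_op M \<phi> =
     {(L2_class M f, L2_class M (f \<circ> \<phi>)) | f. f \<in> sq_integrable M \<and> f \<circ> \<phi> \<in> sq_integrable M}"

text \<open>
  \<open>h\<close> is a version of $\mathsf h_\phi$, which is determined only up to equality almost everywhere.
\<close>

definition is_h_phi :: "'a measure \<Rightarrow> ('a \<Rightarrow> 'a) \<Rightarrow> ('a \<Rightarrow> ennreal) \<Rightarrow> bool" where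
  "is_h_phi M \<phi> h \<longleftrightarrow> h \<in> borel_measurable M \<and>
     (\<forall>\<Delta>\<in>sets M. emeasure M (\<phi> -` \<Delta> \<inter> space M) = (\<integral>\<^sup>+x\<in>\<Delta>. h x \<partial>M))"

end

theory Submission
  imports Defs
begin

text \<open>
  Since $\mu(\phi^{-1}(\mathsf N_\phi)) = \int_{\mathsf N_\phi} \mathsf h_\phi\,d\mu = 0$, the function
  $\chi_{\mathsf N_\phi}\circ\phi$ vanishes a.e.; this gives the equivalence of (ii) and (iii), and it
  shows that $\chi_\Delta$ lies in the kernel of $C_\phi$ for every $\Delta\subseteq\mathsf N_\phi$ of
  finite measure, so (i) implies (ii). Conversely, $f\circ\phi = 0$ a.e. forces $\mathsf h_\phi = 0$
  a.e. on $\{f\neq 0\}$, so $f = 0$ a.e. under (ii). If $C_\phi$ is densely defined, then $\mathsf h_\phi < \infty$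
  a.e., because every $g$ in the domain vanishes a.e. on $\{\mathsf h_\phi = \infty\}$. Hence $X$ is, up
  to a null set, a countable union of sets $Y$ of finite measure on which $\mathsf h_\phi$ is bounded,
  and $\chi_Y$ lies in the domain. Under (iv), $\mu(\Delta\cap\phi^{-1}(Y)) =
  \langle C_\phi\chi_Y,\chi_\Delta\rangle = 0$ for all these $Y$, so $\mu(\Delta) = 0$.
\<close>

section \<open>Square integrable functions\<close>

lemma sq_integrable_cong_AE:
  assumes "f \<in> sq_integrable M" "g \<in> borel_measurable M" "AE x in M. f x = g x"
  shows "g \<in> sq_integrable M"
proof -
  have [measurable]: "f \<in> borel_measurable M" "g \<in> borel_measurable M"
    using assms by (auto simp: sq_integrable_def)
  have "integrable M (\<lambda>x. (cmod (f x))\<^sup>2) = integrable M (\<lambda>x. (cmod (g x))\<^sup>2)"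
    using assms(3) by (intro integrable_cong_AE) (auto elim: eventually_mono)
  then show ?thesis
    using assms by (simp add: sq_integrable_def)
qed

lemma zero_sq_integrable: "(\<lambda>x. 0) \<in> sq_integrable M"
  by (simp add: sq_integrable_def)

lemma indicator_sq_integrable:
  assumes [measurable]: "A \<in> sets M" and "emeasure M A < \<infinity>"
  shows "indicator A \<in> sq_integrable M"
proof -
  have "(\<lambda>x. (cmod (indicator A x))\<^sup>2) = (indicator A :: _ \<Rightarrow> real)"
    by (auto simp: indicator_def)
  then show ?thesis
    using assms by (simp add: sq_integrable_def)
qed

lemma diff_sq_integrable:
  assumes "f \<in> sq_integrable M" "g \<in> sq_integrable M"
  shows "(\<lambda>x. f x - g x) \<in> sq_integrable M"
proof -
  have [measurable]: "f \<in> borel_measurable M" "g \<in> borel_measurable M"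
    using assms by (auto simp: sq_integrable_def)
  \<comment> \<open>An integrable majorant, obtained from the triangle inequality and 2ab \<le> a^2
    + b^2.\<close>
  have bound: "(cmod (f x - g x))\<^sup>2 \<le> 2 * (cmod (f x))\<^sup>2 + 2 * (cmod (g x))\<^sup>2" for x
  proof -
    have "(cmod (f x - g x))\<^sup>2 \<le> (cmod (f x) + cmod (g x))\<^sup>2"
      by (intro power_mono norm_triangle_ineq4) auto
    also have "\<dots> \<le> 2 * (cmod (f x))\<^sup>2 + 2 * (cmod (g x))\<^sup>2"
      using sum_squares_bound[of "cmod (f x)" "cmod (g x)"] by (simp add: power2_sum)
    finally show ?thesis .
  qed
  have "integrable M (\<lambda>x. (cmod (f x - g x))\<^sup>2)"
    by (rule Bochner_Integration.integrable_bound
        [where f = "\<lambda>x. 2 * (cmod (f x))\<^sup>2 + 2 * (cmod (g x))\<^sup>2"])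
      (use assms bound in \<open>auto simp: sq_integrable_def\<close>)
  then show ?thesis
    by (simp add: sq_integrable_def)
qed

section \<open>Classes modulo null sets and their representatives\<close>

lemma L2_class_eq_iff:
  assumes "f \<in> sq_integrable M" "g \<in> sq_integrable M"
  shows "L2_class M f = L2_class M g \<longleftrightarrow> (AE x in M. f x = g x)"
proof
  assume "L2_class M f = L2_class M g"
  moreover have "g \<in> L2_class M g"
    using assms by (simp add: L2_class_def ae_rel_def)
  ultimately have "g \<in> L2_class M f"
    by simp
  then show "AE x in M. f x = g x"
    by (simp add: L2_class_def ae_rel_def)
next
  assume fg: "AE x in M. f x = g x"
  have "(AE x in M. f x = k x) \<longleftrightarrow> (AE x in M. g x = k x)" for k
  proof
    show "AE x in M. g x = k x" if "AE x in M. f x = k x"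
      using fg that by eventually_elim simp
    show "AE x in M. f x = k x" if "AE x in M. g x = k x"
      using fg that by eventually_elim simp
  qed
  then show "L2_class M f = L2_class M g"
    using assms by (auto simp: L2_class_def ae_rel_def)
qed

lemma L2_class_in_L2: "f \<in> sq_integrable M \<Longrightarrow> L2_class M f \<in> L2 M"
  by (auto simp: L2_class_def L2_def intro: quotientI)

text \<open>The class contains \<open>f\<close> itself, so the choice operator picks a genuine
  member. This lets inner products and norms of classes be computed with any given
  representative.\<close>

lemma L2_rep_class:
  assumes "f \<in> sq_integrable M"
  shows "L2_rep (L2_class M f) \<in> sq_integrable M" "AE x in M. L2_rep (L2_class M f) x = f x"
proof -
  have "f \<in> L2_class M f"
    using assms by (simp add: L2_class_def ae_rel_def)
  then have "L2_rep (L2_class M f) \<in> L2_class M f"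
    unfolding L2_rep_def by (rule someI[where P = "\<lambda>g. g \<in> L2_class M f"])
  moreover have "g \<in> sq_integrable M \<and> (AE x in M. f x = g x)" if "g \<in> L2_class M f" for g
    using that by (simp add: L2_class_def ae_rel_def)
  ultimately have
    "L2_rep (L2_class M f) \<in> sq_integrable M \<and> (AE x in M. f x = L2_rep (L2_class M f) x)"
    by blast
  then show "L2_rep (L2_class M f) \<in> sq_integrable M" "AE x in M. L2_rep (L2_class M f) x = f x"
    by (auto elim: eventually_mono)
qed

lemma L2_inner_class:
  assumes "f \<in> sq_integrable M" "g \<in> sq_integrable M"
  shows "L2_inner M (L2_class M f) (L2_class M g) = (LINT x|M. f x * cnj (g x))"
proof -
  note F = L2_rep_class[OF assms(1)] and G = L2_rep_class[OF assms(2)]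
  have [measurable]: "f \<in> borel_measurable M" "g \<in> borel_measurable M"
    "L2_rep (L2_class M f) \<in> borel_measurable M" "L2_rep (L2_class M g) \<in> borel_measurable M"
    using assms F(1) G(1) by (auto simp: sq_integrable_def)
  have [measurable]: "cnj \<in> borel_measurable borel"
    by (intro borel_measurable_continuous_onI continuous_intros)
  have "AE x in M. L2_rep (L2_class M f) x * cnj (L2_rep (L2_class M g) x) = f x * cnj (g x)"
    using F(2) G(2) by eventually_elim simp
  then show ?thesis
    unfolding L2_inner_def by (intro integral_cong_AE) auto
qed

lemma L2_norm_diff_class:
  assumes "f \<in> sq_integrable M" "g \<in> sq_integrable M"
  shows "L2_norm M (L2_diff M (L2_class M f) (L2_class M g)) = sqrt (LINT x|M. (cmod (f x - g x))\<^sup>2)"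
proof -
  let ?d = "\<lambda>x. L2_rep (L2_class M f) x - L2_rep (L2_class M g) x"
  note F = L2_rep_class[OF assms(1)] and G = L2_rep_class[OF assms(2)]
  \<comment> \<open>Two layers of choice have to be undone: \<open>L2_diff\<close> chooses
    representatives of both classes, and \<open>L2_norm\<close> then chooses one of the class of
    their difference.\<close>
  note D = L2_rep_class[OF diff_sq_integrable[OF F(1) G(1)]]
  have [measurable]: "f \<in> borel_measurable M" "g \<in> borel_measurable M"
    "L2_rep (L2_class M ?d) \<in> borel_measurable M"
    using assms D(1) by (auto simp: sq_integrable_def)
  have "AE x in M. L2_rep (L2_class M ?d) x = f x - g x"
    using F(2) G(2) D(2) by eventually_elim simp
  then have "(LINT x|M. (cmod (L2_rep (L2_class M ?d) x))\<^sup>2) = (LINT x|M. (cmod (f x - g x))\<^sup>2)"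
    by (intro integral_cong_AE) (auto elim: eventually_mono)
  then show ?thesis
    by (simp add: L2_norm_def L2_diff_def)
qed

text \<open>Passing to a set of finite measure makes its indicator an element of the Hilbert space.
  Sigma-finiteness rules out a set of infinite measure without subsets of positive finite
  measure.\<close>

lemma (in sigma_finite_measure) finite_measure_subset:
  assumes "A \<in> sets M" "emeasure M A \<noteq> 0"
  obtains B where "B \<in> sets M" "B \<subseteq> A" "emeasure M B \<noteq> 0" "emeasure M B < \<infinity>"
proof (cases "emeasure M A = \<infinity>")
  case True
  obtain Z where "Z \<in> sets M" "Z \<subseteq> A" "emeasure M Z < \<infinity>" "emeasure M Z > ennreal 1"
    using approx_PInf_emeasure_with_finite[OF \<open>A \<in> sets M\<close> True, of 1] by blast
  then show ?thesis
    by (intro that[of Z]) auto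
next
  case False
  then show ?thesis
    using assms by (intro that[of A]) (auto simp: top.not_eq_extremum)
qed

section \<open>The kernel of the composition operator\<close>

lemma composition_op_kernel:
  "F \<in> L2_kernel M (composition_op M \<phi>) \<longleftrightarrow>
    (\<exists>f. F = L2_class M f \<and> f \<in> sq_integrable M \<and> f \<circ> \<phi> \<in> sq_integrable M \<and>
      (AE x in M. f (\<phi> x) = 0))"
proof -
  have "L2_class M (f \<circ> \<phi>) = L2_zero M \<longleftrightarrow> (AE x in M. f (\<phi> x) = 0)"
    if "f \<circ> \<phi> \<in> sq_integrable M" for f :: "'a \<Rightarrow> complex"
    using L2_class_eq_iff[OF that zero_sq_integrable] by (simp add: L2_zero_def)
  then show ?thesis
    unfolding L2_kernel_def composition_op_def mem_Collect_eq Pair_inject by blast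
qed

lemma zero_in_kernel_composition_op: "L2_zero M \<in> L2_kernel M (composition_op M \<phi>)"
  unfolding composition_op_kernel
  by (rule exI[of _ "\<lambda>x. 0"]) (simp add: L2_zero_def comp_def zero_sq_integrable)

lemma zero_in_kernel_adjoint_composition_op:
  "L2_zero M \<in> L2_kernel M (L2_adjoint M (composition_op M \<phi>))"
proof -
  have "L2_inner M (L2_class M g) (L2_zero M) = 0" if "g \<in> sq_integrable M" for g
    using that by (simp add: L2_zero_def L2_inner_class zero_sq_integrable)
  then show ?thesis
    by (auto simp: L2_kernel_def L2_adjoint_def composition_op_def
        L2_class_in_L2[OF zero_sq_integrable, folded L2_zero_def])
qed

text \<open>Identifies \<open>h\<close> as the Radon-Nikodym derivative of the image measure, which
  turns integrals along \<open>\<phi>\<close> into integrals weighted by \<open>h\<close>.\<close>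

lemma distr_eq_density:
  assumes "\<phi> \<in> M \<rightarrow>\<^sub>M M" "is_h_phi M \<phi> h"
  shows "distr M M \<phi> = density M h"
  by (rule measure_eqI)
    (use assms in \<open>auto simp: is_h_phi_def emeasure_distr emeasure_density\<close>)

text \<open>Both sides say that \<open>P\<close> fails almost everywhere for the image measure,
  written once as \<open>distr M M \<phi>\<close> and once as \<open>density M h\<close>.\<close>

lemma AE_composition_zero:
  assumes "is_h_phi M \<phi> h" "\<phi> \<in> M \<rightarrow>\<^sub>M M" "{x \<in> space M. P x} \<in> sets M"
  shows "(AE x in M. \<not> P (\<phi> x)) \<longleftrightarrow> (AE x in M. P x \<longrightarrow> h x = 0)"
proof -
  have [measurable]: "\<phi> \<in> M \<rightarrow>\<^sub>M M" "h \<in> borel_measurable M" "Measurable.pred M P"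
    using assms by (auto simp: is_h_phi_def pred_def)
  have "(AE x in M. \<not> P (\<phi> x)) \<longleftrightarrow> (AE x in distr M M \<phi>. \<not> P x)"
    by (subst AE_distr_iff) auto
  also have "\<dots> \<longleftrightarrow> (AE x in M. P x \<longrightarrow> h x = 0)"
    unfolding distr_eq_density[OF assms(2,1)]
    by (subst AE_density) (auto simp: zero_less_iff_neq_zero intro!: AE_cong)
  finally show ?thesis .
qed

lemma indicator_in_composition_op_kernel:
  assumes "is_h_phi M \<phi> h" "\<phi> \<in> M \<rightarrow>\<^sub>M M" "\<Delta> \<in> sets M" "emeasure M \<Delta> < \<infinity>"
    and zero: "\<And>x. x \<in> \<Delta> \<Longrightarrow> h x = 0"
  shows "L2_class M (indicator \<Delta>) \<in> L2_kernel M (composition_op M \<phi>)"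
proof -
  have [measurable]: "\<phi> \<in> M \<rightarrow>\<^sub>M M" "\<Delta> \<in> sets M"
    using assms by auto
  have "AE x in M. \<phi> x \<notin> \<Delta>"
    by (subst AE_composition_zero[OF assms(1,2)]) (auto simp: zero)
  then have ae: "AE x in M. indicator \<Delta> (\<phi> x) = (0 :: complex)"
    by (auto elim: eventually_mono)
  moreover have "indicator \<Delta> \<circ> \<phi> \<in> sq_integrable M"
    by (rule sq_integrable_cong_AE[OF zero_sq_integrable])
      (use ae in \<open>auto simp: comp_def elim: eventually_mono\<close>)
  ultimately show ?thesis
    unfolding composition_op_kernel using indicator_sq_integrable assms(3,4) by blast
qed

section \<open>Consequences of a dense domain\<close>

lemma h_finite_if_densely_defined:
  assumes "sigma_finite_measure M" "\<phi> \<in> M \<rightarrow>\<^sub>M M" "is_h_phi M \<phi> h"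
    and dense: "L2_densely_defined M (composition_op M \<phi>)"
  shows "AE x in M. h x \<noteq> \<infinity>"
proof (rule ccontr)
  assume not_ae: "\<not> (AE x in M. h x \<noteq> \<infinity>)"
  interpret sigma_finite_measure M by fact
  have [measurable]: "\<phi> \<in> M \<rightarrow>\<^sub>M M" "h \<in> borel_measurable M"
    using assms by (auto simp: is_h_phi_def)
  have "emeasure M {x \<in> space M. h x = \<infinity>} \<noteq> 0"
    using not_ae by (subst (asm) AE_iff_measurable[OF _ refl]) auto
  \<comment> \<open>The indicator of \<open>E\<close> will turn out to have distance at least
    \<open>sqrt e\<close> from the domain, which contradicts density.\<close>
  then obtain E where E [measurable]: "E \<in> sets M" and E_sub: "E \<subseteq> {x \<in> space M. h x = \<infinity>}"
    and E_pos: "emeasure M E \<noteq> 0" and E_fin: "emeasure M E < \<infinity>"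
    by (rule finite_measure_subset[rotated]) measurable
  define e where "e = measure M E"
  have e_pos: "0 < e"
    using E_pos E_fin unfolding e_def
    by (simp add: measure_def enn2real_positive_iff zero_less_iff_neq_zero)
  note IE = indicator_sq_integrable[OF E E_fin]
  obtain g where g: "g \<in> sq_integrable M" "g \<circ> \<phi> \<in> sq_integrable M"
    and small: "L2_norm M (L2_diff M (L2_class M (indicator E)) (L2_class M g)) < sqrt e"
    using dense L2_class_in_L2[OF IE] e_pos
    unfolding L2_densely_defined_def composition_op_def
    by (smt (verit) DomainE Pair_inject mem_Collect_eq real_sqrt_gt_zero)
  have [measurable]: "g \<in> borel_measurable M"
    using g by (simp add: sq_integrable_def)
  \<comment> \<open>Change of variables: the weighted integral is the squared norm of
    \<open>g \<circ> \<phi>\<close>, finite because \<open>g\<close> is in the domain. As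
    \<open>h\<close> is infinite on \<open>E\<close>, this forces \<open>g\<close> to vanish
    there.\<close>
  have "(\<integral>\<^sup>+x. h x * ennreal ((cmod (g x))\<^sup>2) \<partial>M) = (\<integral>\<^sup>+x. ennreal ((cmod (g x))\<^sup>2) \<partial>distr M M \<phi>)"
    unfolding distr_eq_density[OF assms(2,3)] by (subst nn_integral_density) auto
  also have "\<dots> = (\<integral>\<^sup>+x. ennreal ((cmod ((g \<circ> \<phi>) x))\<^sup>2) \<partial>M)"
    by (subst nn_integral_distr) auto
  also have "\<dots> \<noteq> \<infinity>"
    using g(2) by (simp add: sq_integrable_def integrable_iff_bounded)
  finally have "AE x in M. h x * ennreal ((cmod (g x))\<^sup>2) \<noteq> \<infinity>"
    by (intro nn_integral_PInf_AE) auto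
  then have vanish: "AE x in M. x \<in> E \<longrightarrow> g x = 0"
    by eventually_elim (use E_sub in \<open>auto simp: ennreal_top_mult split: if_splits\<close>)
  have "e = (LINT x|M. indicator E x)"
    using sets.sets_into_space[OF E] by (simp add: e_def Int_absorb2)
  also have "\<dots> \<le> (LINT x|M. (cmod (indicator E x - g x))\<^sup>2)"
  proof (rule integral_mono_AE)
    show "integrable M (indicator E :: 'a \<Rightarrow> real)"
      using E_fin by simp
    show "integrable M (\<lambda>x. (cmod (indicator E x - g x))\<^sup>2)"
      using diff_sq_integrable[OF IE g(1)] by (simp add: sq_integrable_def)
    \<comment> \<open>On \<open>E\<close> both sides equal 1 since \<open>g\<close> vanishes; off
      \<open>E\<close> the left side is 0.\<close>
    show "AE x in M. indicator E x \<le> (cmod (indicator E x - g x))\<^sup>2"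
      using vanish by eventually_elim (auto simp: indicator_def)
  qed
  also have "\<dots> < e"
    using small by (simp add: L2_norm_diff_class[OF IE g(1)])
  finally show False
    by simp
qed

text \<open>The preimage of \<open>Y\<close> has measure at most \<open>n\<close> times that of
  \<open>Y\<close>, hence finite. This supplies test functions in the domain of the composition
  operator.\<close>

lemma indicator_composition_sq_integrable:
  assumes "is_h_phi M \<phi> h" "\<phi> \<in> M \<rightarrow>\<^sub>M M" "Y \<in> sets M" "emeasure M Y < \<infinity>"
    and bound: "\<And>x. x \<in> Y \<Longrightarrow> h x \<le> of_nat n"
  shows "indicator Y \<circ> \<phi> \<in> sq_integrable M"
proof -
  have [measurable]: "\<phi> \<in> M \<rightarrow>\<^sub>M M" "Y \<in> sets M"
    using assms by auto
  have "emeasure M (\<phi> -` Y \<inter> space M) = (\<integral>\<^sup>+x\<in>Y. h x \<partial>M)"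
    using assms by (simp add: is_h_phi_def)
  also have "\<dots> \<le> (\<integral>\<^sup>+x. of_nat n * indicator Y x \<partial>M)"
    by (intro nn_integral_mono) (auto simp: bound split: split_indicator)
  also have "\<dots> = of_nat n * emeasure M Y"
    by (simp add: nn_integral_cmult_indicator)
  also have "\<dots> < \<infinity>"
    using assms(4) by (simp add: ennreal_mult_less_top of_nat_less_top)
  finally have "indicator (\<phi> -` Y \<inter> space M) \<in> sq_integrable M"
    by (intro indicator_sq_integrable) auto
  then show ?thesis
    by (rule sq_integrable_cong_AE) (auto simp: comp_def indicator_def)
qed

text \<open>Membership in the kernel of the adjoint means orthogonality to the range. Testing
  against images of indicators shows that \<open>\<Delta>\<close> meets the preimage of each test
  set in a null set, and countably many such preimages cover almost all of the space.\<close>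

lemma null_of_kernel_adjoint:
  assumes "sigma_finite_measure M" "nonsingular M \<phi>" "is_h_phi M \<phi> h"
    and dense: "L2_densely_defined M (composition_op M \<phi>)"
    and \<Delta>: "\<Delta> \<in> sets M" "emeasure M \<Delta> < \<infinity>"
    and kernel: "L2_class M (indicator \<Delta>) \<in> L2_kernel M (L2_adjoint M (composition_op M \<phi>))"
  shows "emeasure M \<Delta> = 0"
proof -
  interpret sigma_finite_measure M by fact
  have \<phi> [measurable]: "\<phi> \<in> M \<rightarrow>\<^sub>M M" and [measurable]: "h \<in> borel_measurable M"
    and [measurable]: "\<Delta> \<in> sets M"
    using assms by (auto simp: is_h_phi_def nonsingular_def)
  obtain A :: "nat \<Rightarrow> 'a set" where A: "range A \<subseteq> sets M" "(\<Union>i. A i) = space M"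
    "\<And>i. emeasure M (A i) \<noteq> \<infinity>"
    using sigma_finite by blast
  \<comment> \<open>Intersecting with \<open>A i\<close> gives finite measure, and the bound
    \<open>n\<close> on \<open>h\<close> puts the indicator into the domain. The union over
    \<open>i\<close> and \<open>n\<close> is the set where \<open>h\<close> is finite.\<close>
  define Y where "Y i n = {x \<in> A i. h x \<le> of_nat n}" for i n :: nat
  have [measurable]: "A i \<in> sets M" for i
    using A by auto
  have Y_eq: "Y i n = A i \<inter> {x \<in> space M. h x \<le> of_nat n}" for i n
    using sets.sets_into_space[of "A i" M] by (auto simp: Y_def)
  have Y [measurable]: "Y i n \<in> sets M" for i n
    unfolding Y_eq by measurable
  have Y_fin: "emeasure M (Y i n) < \<infinity>" for i n
  proof -
    have "emeasure M (Y i n) \<le> emeasure M (A i)"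
      by (rule emeasure_mono) (auto simp: Y_def)
    then show ?thesis
      using A(3)[of i] by (simp add: top.not_eq_extremum le_less_trans)
  qed
  have step: "AE x in M. x \<in> \<Delta> \<longrightarrow> \<phi> x \<notin> Y i n" for i n
  proof -
    note IY = indicator_sq_integrable[OF Y Y_fin, of i n]
    have IYphi: "indicator (Y i n) \<circ> \<phi> \<in> sq_integrable M"
      by (rule indicator_composition_sq_integrable[OF assms(3) \<phi> Y Y_fin, where n = n])
        (simp add: Y_def)
    note I\<Delta> = indicator_sq_integrable[OF \<Delta>]
    let ?B = "\<phi> -` Y i n \<inter> space M \<inter> \<Delta>"
    \<comment> \<open>Finiteness is needed later: \<open>measure\<close> also takes the value 0 on
      sets of infinite measure, so a zero integral alone would not make \<open>?B\<close>
      null.\<close>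
    have "emeasure M ?B \<le> emeasure M \<Delta>"
      by (rule emeasure_mono) auto
    then have B_fin: "emeasure M ?B < \<infinity>"
      using \<Delta>(2) by (rule le_less_trans)
    have "(L2_class M (indicator (Y i n)), L2_class M (indicator (Y i n) \<circ> \<phi>)) \<in> composition_op M \<phi>"
      using IY IYphi by (auto simp: composition_op_def)
    then have "L2_inner M (L2_class M (indicator (Y i n) \<circ> \<phi>)) (L2_class M (indicator \<Delta>)) =
        L2_inner M (L2_class M (indicator (Y i n))) (L2_class M (\<lambda>x. 0))"
      using kernel by (auto simp: L2_kernel_def L2_adjoint_def L2_zero_def)
    then have "(LINT x|M. indicator (Y i n) (\<phi> x) * cnj (indicator \<Delta> x)) = 0"
      by (simp add: L2_inner_class IY IYphi I\<Delta> zero_sq_integrable)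
    also have "(LINT x|M. indicator (Y i n) (\<phi> x) * cnj (indicator \<Delta> x)) =
        (LINT x|M. complex_of_real (indicator ?B x))"
      by (rule Bochner_Integration.integral_cong) (auto simp: indicator_def)
    also have "\<dots> = complex_of_real (measure M ?B)"
    proof -
      have "?B \<inter> space M = ?B"
        by auto
      then show ?thesis
        by (subst integral_complex_of_real) simp
    qed
    finally have "emeasure M ?B = 0"
      using B_fin by (simp add: emeasure_eq_ennreal_measure top.not_eq_extremum)
    then show ?thesis
      by (subst AE_iff_measurable[of ?B]) (auto dest: sets.sets_into_space[OF \<Delta>(1), THEN subsetD])
  qed
  \<comment> \<open>Absolute continuity of the image measure carries the finiteness of
    \<open>h\<close> over to the points \<open>\<phi> x\<close>.\<close>
  have "AE x in distr M M \<phi>. h x \<noteq> \<infinity>"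
    by (rule absolutely_continuous_AE[of _ M])
      (use assms h_finite_if_densely_defined[OF assms(1) \<phi> assms(3) dense] in
        \<open>auto simp: nonsingular_def\<close>)
  then have h_fin: "AE x in M. h (\<phi> x) \<noteq> \<infinity>"
    by (subst (asm) AE_distr_iff) auto
  have "AE x in M. \<forall>i n. x \<in> \<Delta> \<longrightarrow> \<phi> x \<notin> Y i n"
    unfolding AE_all_countable using step by blast
  with h_fin AE_space have "AE x in M. x \<notin> \<Delta>"
  proof eventually_elim
    fix x assume x: "h (\<phi> x) \<noteq> \<infinity>" "x \<in> space M" "\<forall>i n. x \<in> \<Delta> \<longrightarrow> \<phi> x \<notin> Y i n"
    then have "\<phi> x \<in> space M"
      using measurable_space[OF \<phi>] by blast
    then obtain i where "\<phi> x \<in> A i"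
      using A(2) by blast
    moreover obtain n where "h (\<phi> x) \<le> of_nat n"
      using ennreal_Ex_less_of_nat[of "h (\<phi> x)"] x(1)
      by (auto simp: top.not_eq_extremum intro: less_imp_le)
    ultimately show "x \<notin> \<Delta>"
      using x(3) by (auto simp: Y_def)
  qed
  then show ?thesis
    by (subst (asm) AE_iff_measurable[of \<Delta>]) (auto dest: sets.sets_into_space[OF \<Delta>(1), THEN subsetD])
qed

theorem proposition6p2:
  fixes M :: "'a measure" and \<phi> :: "'a \<Rightarrow> 'a" and h\<^sub>\<phi> :: "'a \<Rightarrow> ennreal"
    and N\<^sub>\<phi> :: "'a set" and C\<^sub>\<phi> :: "'a L2_op"
  assumes "sigma_finite_measure M"
    and "nonsingular M \<phi>"
    and "is_h_phi M \<phi> h\<^sub>\<phi>"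
  defines "N\<^sub>\<phi> \<equiv> {x \<in> space M. h\<^sub>\<phi> x = 0}"
    and "C\<^sub>\<phi> \<equiv> composition_op M \<phi>"
  shows "((L2_kernel M C\<^sub>\<phi> = {L2_zero M}) \<longleftrightarrow> emeasure M N\<^sub>\<phi> = 0) \<and>
    (emeasure M N\<^sub>\<phi> = 0 \<longleftrightarrow>
      (AE x in M. ((indicator N\<^sub>\<phi> :: 'a \<Rightarrow> complex) \<circ> \<phi>) x = indicator N\<^sub>\<phi> x)) \<and>
    (L2_densely_defined M C\<^sub>\<phi> \<longrightarrow>
      ((L2_kernel M C\<^sub>\<phi> = {L2_zero M}) \<longleftrightarrow>
        L2_kernel M C\<^sub>\<phi> \<subseteq> L2_kernel M (L2_adjoint M C\<^sub>\<phi>)))"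
proof -
  interpret sigma_finite_measure M by fact
  have \<phi> [measurable]: "\<phi> \<in> M \<rightarrow>\<^sub>M M" and h [measurable]: "h\<^sub>\<phi> \<in> borel_measurable M"
    using assms(2,3) by (auto simp: nonsingular_def is_h_phi_def)
  have N [measurable]: "N\<^sub>\<phi> \<in> sets M"
    unfolding N\<^sub>\<phi>_def by measurable
  have null_iff: "emeasure M N\<^sub>\<phi> = 0 \<longleftrightarrow> (AE x in M. x \<notin> N\<^sub>\<phi>)"
    by (subst AE_iff_measurable[of N\<^sub>\<phi>]) (auto simp: N\<^sub>\<phi>_def)
  \<comment> \<open>The common core of (i) \<Longrightarrow> (ii) and (iv) \<Longrightarrow> (ii):
    were (ii) false, some non-null subset of \<open>N\<^sub>\<phi>\<close> of finite measure would
    have its indicator in the kernel.\<close>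
  have finite_null: "emeasure M N\<^sub>\<phi> = 0"
    if "\<And>\<Delta>. \<lbrakk>\<Delta> \<in> sets M; emeasure M \<Delta> < \<infinity>;
      L2_class M (indicator \<Delta>) \<in> L2_kernel M C\<^sub>\<phi>\<rbrakk> \<Longrightarrow> emeasure M \<Delta> = 0"
  proof (rule ccontr)
    assume "emeasure M N\<^sub>\<phi> \<noteq> 0"
    then obtain \<Delta> where \<Delta>: "\<Delta> \<in> sets M" "\<Delta> \<subseteq> N\<^sub>\<phi>" "emeasure M \<Delta> \<noteq> 0" "emeasure M \<Delta> < \<infinity>"
      using finite_measure_subset[OF N] by blast
    then have "L2_class M (indicator \<Delta>) \<in> L2_kernel M C\<^sub>\<phi>"
      unfolding C\<^sub>\<phi>_def
      by (intro indicator_in_composition_op_kernel[OF assms(3) \<phi>]) (auto simp: N\<^sub>\<phi>_def)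
    with that \<Delta> show False
      by blast
  qed
  have i_ii: "L2_kernel M C\<^sub>\<phi> = {L2_zero M} \<longleftrightarrow> emeasure M N\<^sub>\<phi> = 0"
  proof
    assume kernel: "L2_kernel M C\<^sub>\<phi> = {L2_zero M}"
    show "emeasure M N\<^sub>\<phi> = 0"
    proof (rule finite_null)
      fix \<Delta> assume \<Delta>: "\<Delta> \<in> sets M" "emeasure M \<Delta> < \<infinity>"
        and "L2_class M (indicator \<Delta>) \<in> L2_kernel M C\<^sub>\<phi>"
      then have "AE x in M. indicator \<Delta> x = (0 :: complex)"
        using kernel L2_class_eq_iff[OF indicator_sq_integrable[OF \<Delta>] zero_sq_integrable]
        by (simp add: L2_zero_def)
      then show "emeasure M \<Delta> = 0"
        by (subst (asm) AE_iff_measurable[of \<Delta>])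
          (use \<Delta> in \<open>auto simp: indicator_def dest: sets.sets_into_space\<close>)
    qed
  next
    assume "emeasure M N\<^sub>\<phi> = 0"
    then have pos: "AE x in M. h\<^sub>\<phi> x \<noteq> 0"
      unfolding null_iff using AE_space by eventually_elim (simp add: N\<^sub>\<phi>_def)
    have "F = L2_zero M" if F: "F \<in> L2_kernel M C\<^sub>\<phi>" for F
    proof -
      obtain f where f: "F = L2_class M f" "f \<in> sq_integrable M" "AE x in M. f (\<phi> x) = 0"
        using F unfolding C\<^sub>\<phi>_def composition_op_kernel by blast
      have [measurable]: "f \<in> borel_measurable M"
        using f by (simp add: sq_integrable_def)
      \<comment> \<open>The transfer along \<open>\<phi>\<close> is applied to the property
        \<open>f x \<noteq> 0\<close>.\<close>
      have "AE x in M. f x \<noteq> 0 \<longrightarrow> h\<^sub>\<phi> x = 0"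
        by (subst AE_composition_zero[OF assms(3) \<phi>, symmetric]) (use f(3) in auto)
      with pos have "AE x in M. f x = 0"
        by eventually_elim auto
      then show ?thesis
        using f L2_class_eq_iff[OF f(2) zero_sq_integrable] by (simp add: L2_zero_def)
    qed
    moreover have "L2_zero M \<in> L2_kernel M C\<^sub>\<phi>"
      unfolding C\<^sub>\<phi>_def by (rule zero_in_kernel_composition_op)
    ultimately show "L2_kernel M C\<^sub>\<phi> = {L2_zero M}"
      by blast
  qed
  \<comment> \<open>The left side of (iii) therefore vanishes almost everywhere, so (iii) reduces to
    the vanishing of the indicator of \<open>N\<^sub>\<phi>\<close>.\<close>
  have "AE x in M. \<phi> x \<notin> N\<^sub>\<phi>"
    by (subst AE_composition_zero[OF assms(3) \<phi>]) (auto simp: N\<^sub>\<phi>_def)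
  then have ii_iii: "emeasure M N\<^sub>\<phi> = 0 \<longleftrightarrow>
      (AE x in M. ((indicator N\<^sub>\<phi> :: 'a \<Rightarrow> complex) \<circ> \<phi>) x = indicator N\<^sub>\<phi> x)"
    unfolding null_iff
    by (intro AE_cong_simp eventually_subst) (auto elim: eventually_mono simp: indicator_def)
  have i_iv: "L2_kernel M C\<^sub>\<phi> = {L2_zero M} \<longleftrightarrow>
      L2_kernel M C\<^sub>\<phi> \<subseteq> L2_kernel M (L2_adjoint M C\<^sub>\<phi>)" if "L2_densely_defined M C\<^sub>\<phi>"
  proof
    assume "L2_kernel M C\<^sub>\<phi> = {L2_zero M}"
    then show "L2_kernel M C\<^sub>\<phi> \<subseteq> L2_kernel M (L2_adjoint M C\<^sub>\<phi>)"
      using zero_in_kernel_adjoint_composition_op[of M \<phi>] by (simp add: C\<^sub>\<phi>_def)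
  next
    assume "L2_kernel M C\<^sub>\<phi> \<subseteq> L2_kernel M (L2_adjoint M C\<^sub>\<phi>)"
    \<comment> \<open>Under (iv), an indicator in the kernel also lies in the kernel of the adjoint,
      so its set is null. This gives (ii), and then (i) by the equivalence above.\<close>
    then have "emeasure M N\<^sub>\<phi> = 0"
      by (intro finite_null null_of_kernel_adjoint[OF assms(1-3)])
        (use that in \<open>auto simp: C\<^sub>\<phi>_def\<close>)
    then show "L2_kernel M C\<^sub>\<phi> = {L2_zero M}"
      by (simp add: i_ii)
  qed
  show ?thesis
    using i_ii ii_iii i_iv by blast
qed

end
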